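(* Fix $\Delta>0$. For $\epsilon>0$ and $\gamma\in[0,1]$, let $f_\gamma$ be the two-dimensional staircase-shaped probability density function on $\mathbb{R}^2$ with parameters $\epsilon,\Delta,\gamma$ (defined in the context), and let $$V^*=V^*(\epsilon)=\min_{\gamma\in[0,1]}\int_{\mathbb{R}^2}\|\mathbf{x}\|_1 f_\gamma(\mathbf{x})\,d\mathbf{x}.$$ Then $$V^*=\frac{2\Delta}{\epsilon}-\frac{\Delta\,\epsilon^2}{36\sqrt{3}}+O(\epsilon^3)\quad\text{as }\epsilon\to0^+,$$ and $$V^*=\sqrt[3]{2}\,\Delta\, e^{-\epsilon/3}+\frac{\Delta\, e^{-2\epsilon/3}}{\sqrt[3]{2}}+o\!\left(e^{-2\epsilon/3}\right)\quad\text{as }\epsilon\to+\infty.$$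
   Context: Notation: $\mathbf{x}=(x_1,x_2)$, $\|\mathbf{x}\|_1=|x_1|+|x_2|$, $\mathbb{N}=\{0,1,2,\dots\}$. For $\gamma\in[0,1]$ the staircase-shaped density is $$f_\gamma(\mathbf{x})=\begin{cases} e^{-k\epsilon}a(\gamma), & \|\mathbf{x}\|_1\in[k\Delta,(k+\gamma)\Delta),\ k\in\mathbb{N},\\ e^{-(k+1)\epsilon}a(\gamma), & \|\mathbf{x}\|_1\in[(k+\gamma)\Delta,(k+1)\Delta),\ k\in\mathbb{N},\end{cases}$$ where $a(\gamma)>0$ is the normalization constant making $\int_{\mathbb{R}^2}f_\gamma(\mathbf{x})\,d\mathbf{x}=1$. *)

theory Defs
  imports "HOL-Analysis.Analysis" "HOL-Library.Landau_Symbols"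
begin

definition l1_norm :: "real \<times> real \<Rightarrow> real" where
  "l1_norm x = \<bar>fst x\<bar> + \<bar>snd x\<bar>"

text \<open>
  For \<open>\<Delta> > 0\<close>, the index \<open>k\<close> below is the unique natural number with
  \<open>k * \<Delta> \<le> l1_norm x < (k + 1) * \<Delta>\<close>; the lemmas after the definition recover the two
  cases with their half-open intervals.
\<close>

definition staircase :: "real \<Rightarrow> real \<Rightarrow> real \<Rightarrow> real \<Rightarrow> real \<times> real \<Rightarrow> real" where
  "staircase a \<epsilon> \<Delta> \<gamma> x =
     (let k = nat \<lfloor>l1_norm x / \<Delta>\<rfloor> in
      if l1_norm x < (real k + \<gamma>) * \<Delta> then exp (- (real k * \<epsilon>)) * a
      else exp (- ((real k + 1) * \<epsilon>)) * a)"

lemma staircase_index: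
  assumes "\<Delta> > 0" "real k * \<Delta> \<le> r" "r < (real k + 1) * \<Delta>"
  shows "nat \<lfloor>r / \<Delta>\<rfloor> = k"
proof -
  have "\<lfloor>r / \<Delta>\<rfloor> = int k"
    using assms by (intro floor_unique) (simp_all add: field_simps)
  then show ?thesis by simp
qed

lemma staircase_upper:
  assumes "\<Delta> > 0" "\<gamma> \<in> {0..1}" "l1_norm x \<in> {real k * \<Delta>..<(real k + \<gamma>) * \<Delta>}"
  shows "staircase a \<epsilon> \<Delta> \<gamma> x = exp (- (real k * \<epsilon>)) * a"
proof -
  have "(real k + \<gamma>) * \<Delta> \<le> (real k + 1) * \<Delta>"
    using assms by (intro mult_right_mono) auto
  then have "real k * \<Delta> \<le> l1_norm x" "l1_norm x < (real k + 1) * \<Delta>"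
    using assms(3) unfolding atLeastLessThan_iff by linarith+
  then have "nat \<lfloor>l1_norm x / \<Delta>\<rfloor> = k"
    using assms(1) by (intro staircase_index)
  then show ?thesis using assms by (simp add: staircase_def)
qed

lemma staircase_lower:
  assumes "\<Delta> > 0" "\<gamma> \<in> {0..1}" "l1_norm x \<in> {(real k + \<gamma>) * \<Delta>..<(real k + 1) * \<Delta>}"
  shows "staircase a \<epsilon> \<Delta> \<gamma> x = exp (- ((real k + 1) * \<epsilon>)) * a"
proof -
  have "real k * \<Delta> \<le> (real k + \<gamma>) * \<Delta>"
    using assms by (intro mult_right_mono) auto
  then have "real k * \<Delta> \<le> l1_norm x" "l1_norm x < (real k + 1) * \<Delta>"
    using assms(3) unfolding atLeastLessThan_iff by linarith+
  then have "nat \<lfloor>l1_norm x / \<Delta>\<rfloor> = k"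
    using assms(1) by (intro staircase_index)
  then show ?thesis using assms by (simp add: staircase_def)
qed

text \<open>
  A Bochner integral equal to \<open>1\<close> entails integrability, as it is \<open>0\<close> for non-integrable functions.
\<close>

definition norm_const :: "real \<Rightarrow> real \<Rightarrow> real \<Rightarrow> real" where
  "norm_const \<epsilon> \<Delta> \<gamma> = (THE a. a > 0 \<and> (LINT x|lborel. staircase a \<epsilon> \<Delta> \<gamma> x) = 1)"

definition staircase_density :: "real \<Rightarrow> real \<Rightarrow> real \<Rightarrow> real \<times> real \<Rightarrow> real" where
  "staircase_density \<epsilon> \<Delta> \<gamma> = staircase (norm_const \<epsilon> \<Delta> \<gamma>) \<epsilon> \<Delta> \<gamma>"

definition expected_l1 :: "real \<Rightarrow> real \<Rightarrow> real \<Rightarrow> real" where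
  "expected_l1 \<epsilon> \<Delta> \<gamma> = (LINT x|lborel. l1_norm x * staircase_density \<epsilon> \<Delta> \<gamma> x)"

text \<open>
  Defined as an infimum; that it is an attained minimum is asserted separately where it is used.
\<close>

definition V_star :: "real \<Rightarrow> real \<Rightarrow> real" where
  "V_star \<Delta> \<epsilon> = (INF \<gamma>\<in>{0..1}. expected_l1 \<epsilon> \<Delta> \<gamma>)"

end

theory Submission
  imports Defs "HOL-Real_Asymp.Real_Asymp"
begin

text \<open>
  With \<open>b = exp (- \<epsilon>)\<close>, the staircase is the mixture \<open>a (\<Sum>k. (1 - b) b ^ k 1(l1_norm < (k + \<gamma>) \<Delta>))\<close>
  of indicators of balls, and a ball of radius \<open>R\<close> has area \<open>2 R\<^sup>2\<close> and first moment \<open>4 R\<^sup>3 / 3\<close>.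
  So the expected norm is \<open>(2 / 3) \<Delta> E (K + \<gamma>)\<^sup>3 / E (K + \<gamma>)\<^sup>2\<close> with \<open>K\<close> geometric of mean
  \<open>m = 1 / (exp \<epsilon> - 1)\<close>, a rational function of \<open>m\<close> and \<open>\<gamma>\<close>.

  For small \<open>\<epsilon>\<close>, put \<open>x = m + 1 / 2\<close> and \<open>t = \<gamma> - 1 / 2\<close>: up to the factor \<open>\<Delta>\<close> the expected norm is
  \<open>2 x - 1 / (6 x) + (t\<^sup>3 - t / 4) / (3 x\<^sup>2) + O(1 / x\<^sup>3)\<close> uniformly in \<open>t\<close>, and the minimum of
  \<open>t\<^sup>3 - t / 4\<close> is \<open>- 1 / (12 \<surd>3)\<close>. For large \<open>\<epsilon>\<close>, put \<open>m = \<beta>\<^sup>3\<close> and \<open>\<gamma> = \<beta> y\<close>: the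
  leading term \<open>(2 / 3) \<beta> (y + 1 / y\<^sup>2)\<close> is minimal at \<open>y = c\<close> with \<open>c\<^sup>3 = 2\<close>, and near that point the next
  order is \<open>\<beta>\<^sup>2 / c\<close>.
\<close>

section \<open>Area and first moment of the l1 ball\<close>

text \<open>At 0 the difference quotient is the absolute value of the increment. One antiderivative
  of \<open>2 * \<bar>y\<bar>\<close> thus serves both signs, and the ball integrals need no
  splitting at the axes.\<close>

lemma DERIV_mult_abs: "((\<lambda>y. y * \<bar>y\<bar>) has_real_derivative 2 * \<bar>y\<bar>) (at y)" for y :: real
proof (cases y "0::real" rule: linorder_cases)
  case less
  have "((\<lambda>y. - (y\<^sup>2)) has_real_derivative 2 * \<bar>y\<bar>) (at y)"
    using less by (auto intro!: derivative_eq_intros)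
  then show ?thesis
    by (rule has_field_derivative_transform_within_open[of _ _ _ "{..<0}"])
       (use less in \<open>auto simp: power2_eq_square\<close>)
next
  case equal
  have "((\<lambda>h::real. \<bar>h\<bar>) \<longlongrightarrow> 0) (at 0)"
    by (rule tendsto_eq_intros refl | simp)+
  then have "((\<lambda>h::real. (0 + h) * \<bar>0 + h\<bar> / h) \<longlongrightarrow> 0) (at 0)"
    by (rule Lim_transform_eventually) (auto simp: eventually_at_filter)
  then show ?thesis
    using equal by (simp add: DERIV_def)
next
  case greater
  have "((\<lambda>y. y\<^sup>2) has_real_derivative 2 * \<bar>y\<bar>) (at y)"
    using greater by (auto intro!: derivative_eq_intros)
  then show ?thesis
    by (rule has_field_derivative_transform_within_open[of _ _ _ "{0<..}"])
       (use greater in \<open>auto simp: power2_eq_square\<close>)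
qed

lemma l1_norm_nonneg: "l1_norm p \<ge> 0"
  by (simp add: l1_norm_def)

lemma l1_norm_measurable [measurable]: "l1_norm \<in> borel_measurable borel"
  unfolding l1_norm_def by (intro borel_measurable_continuous_onI continuous_intros)

text \<open>Tonelli: the slice of the ball at \<open>x\<close> is the interval of radius
  \<open>R - \<bar>x\<bar>\<close> around 0, integrated by \<open>G x\<close>; \<open>H\<close> then
  integrates the slice values.\<close>

lemma nn_integral_l1_ball:
  fixes g :: "real \<times> real \<Rightarrow> real" and G :: "real \<Rightarrow> real \<Rightarrow> real" and H :: "real \<Rightarrow> real"
  assumes R: "R \<ge> 0" and g [measurable]: "g \<in> borel_measurable borel" and g_nonneg: "\<And>p. g p \<ge> 0"
    and G: "\<And>x y. (G x has_real_derivative g (x, y)) (at y)"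
    and cont: "continuous_on UNIV (\<lambda>x. G x (R - \<bar>x\<bar>) - G x (\<bar>x\<bar> - R))"
    and H: "\<And>x. x \<in> {- R..R} \<Longrightarrow> (H has_real_derivative G x (R - \<bar>x\<bar>) - G x (\<bar>x\<bar> - R)) (at x)"
  shows "(\<integral>\<^sup>+p. ennreal (g p * indicator {p. l1_norm p < R} p) \<partial>lborel) = ennreal (H R - H (- R))"
proof -
  define h where "h x = G x (R - \<bar>x\<bar>) - G x (\<bar>x\<bar> - R)" for x
  have inner: "(\<integral>\<^sup>+y. ennreal (g (x, y) * indicator {p. l1_norm p < R} (x, y)) \<partial>lborel) =
      ennreal (h x) * indicator {- R..R} x" for x
  proof (cases "\<bar>x\<bar> \<le> R")
    case True
    \<comment> \<open>The slice is an open interval; adding its two endpoints, a null set, gives the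
      closed interval of the fundamental theorem.\<close>
    have "(\<integral>\<^sup>+y. ennreal (g (x, y) * indicator {p. l1_norm p < R} (x, y)) \<partial>lborel) =
        (\<integral>\<^sup>+y. ennreal (g (x, y)) * indicator {\<bar>x\<bar> - R..R - \<bar>x\<bar>} y \<partial>lborel)"
      using AE_lborel_singleton[of "\<bar>x\<bar> - R"] AE_lborel_singleton[of "R - \<bar>x\<bar>"]
      by (intro nn_integral_cong_AE, eventually_elim) (auto simp: l1_norm_def indicator_def)
    also have "\<dots> = ennreal (h x)"
      unfolding h_def using True g_nonneg
      by (intro nn_integral_FTC_Icc) (auto intro!: DERIV_subset[OF G])
    finally show ?thesis using True by (auto simp: indicator_def abs_le_iff)
  next
    case False
    then have "indicator {p. l1_norm p < R} (x, y) = (0::real)" for y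
      by (auto simp: l1_norm_def indicator_def)
    then show ?thesis using False by (auto simp: indicator_def abs_le_iff)
  qed
  have h_nonneg: "h x \<ge> 0" if "x \<in> {- R..R}" for x
  proof -
    have "G x (\<bar>x\<bar> - R) \<le> G x (R - \<bar>x\<bar>)"
      using that by (intro DERIV_nonneg_imp_nondecreasing[of _ _ "G x"]) (use that in auto, use G g_nonneg in blast)
    then show ?thesis by (simp add: h_def)
  qed
  have h_meas: "h \<in> borel_measurable borel"
    using cont by (intro borel_measurable_continuous_onI) (simp add: h_def)
  have "(\<integral>\<^sup>+p. ennreal (g p * indicator {p. l1_norm p < R} p) \<partial>lborel) =
      (\<integral>\<^sup>+x. \<integral>\<^sup>+y. ennreal (g (x, y) * indicator {p. l1_norm p < R} (x, y)) \<partial>lborel \<partial>lborel)"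
  proof (subst lborel_prod[symmetric], subst lborel.nn_integral_fst[symmetric])
    show "(\<lambda>p. ennreal (g p * indicator {p. l1_norm p < R} p)) \<in> borel_measurable (lborel \<Otimes>\<^sub>M lborel)"
      unfolding lborel_prod by measurable
  qed simp
  also have "\<dots> = (\<integral>\<^sup>+x. ennreal (h x) * indicator {- R..R} x \<partial>lborel)"
    by (simp add: inner)
  also have "\<dots> = ennreal (H R - H (- R))"
    using R h_nonneg h_meas
    by (intro nn_integral_FTC_Icc) (auto intro!: DERIV_subset[OF H[folded h_def]])
  finally show ?thesis .
qed

lemma has_bochner_integral_l1_ball:
  assumes "R \<ge> 0"
  shows "has_bochner_integral lborel (indicator {p. l1_norm p < R}) (2 * R\<^sup>2)"
proof (rule has_bochner_integral_nn_integral)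
  have "(\<integral>\<^sup>+p. ennreal ((\<lambda>p. 1) p * indicator {p. l1_norm p < R} p) \<partial>lborel) =
      ennreal ((2 * R * R - R * \<bar>R\<bar>) - (2 * R * (- R) - (- R) * \<bar>- R\<bar>))"
  proof (rule nn_integral_l1_ball[OF assms, where G = "\<lambda>x y. y"])
    show "((\<lambda>x. 2 * R * x - x * \<bar>x\<bar>) has_real_derivative (R - \<bar>x\<bar>) - (\<bar>x\<bar> - R)) (at x)" for x
      by (rule derivative_eq_intros DERIV_mult_abs refl | simp)+
  qed (auto intro!: continuous_intros derivative_eq_intros)
  also have "(2 * R * R - R * \<bar>R\<bar>) - (2 * R * (- R) - (- R) * \<bar>- R\<bar>) = 2 * R\<^sup>2"
    using assms by (simp add: power2_eq_square)
  finally show "(\<integral>\<^sup>+p. ennreal (indicator {p. l1_norm p < R} p) \<partial>lborel) = ennreal (2 * R\<^sup>2)"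
    by simp
qed auto

lemma has_bochner_integral_l1_norm_l1_ball:
  assumes "R \<ge> 0"
  shows "has_bochner_integral lborel (\<lambda>p. l1_norm p * indicator {p. l1_norm p < R} p) (4 / 3 * R ^ 3)"
proof (rule has_bochner_integral_nn_integral)
  have "(\<integral>\<^sup>+p. ennreal (l1_norm p * indicator {p. l1_norm p < R} p) \<partial>lborel) =
      ennreal ((R\<^sup>2 * R - R ^ 3 / 3) - (R\<^sup>2 * (- R) - (- R) ^ 3 / 3))"
  proof (rule nn_integral_l1_ball[OF assms, where G = "\<lambda>x y. \<bar>x\<bar> * y + y * \<bar>y\<bar> / 2"])
    show "((\<lambda>y. \<bar>x\<bar> * y + y * \<bar>y\<bar> / 2) has_real_derivative l1_norm (x, y)) (at y)" for x y
      by (rule derivative_eq_intros DERIV_mult_abs refl | simp add: l1_norm_def)+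
    \<comment> \<open>With the absolute values resolved, the slice integral is \<open>(R -
      \<bar>x\<bar>) * (R + \<bar>x\<bar>) = R\<^sup>2 - x\<^sup>2\<close>, whence the polynomial
      antiderivative.\<close>
    have abs_eq: "\<bar>\<bar>x\<bar> - R\<bar> = R - \<bar>x\<bar>" "\<bar>R - \<bar>x\<bar>\<bar> = R - \<bar>x\<bar>" if "x \<in> {- R..R}" for x
      using that by auto
    show "((\<lambda>x. R\<^sup>2 * x - x ^ 3 / 3) has_real_derivative
        \<bar>x\<bar> * (R - \<bar>x\<bar>) + (R - \<bar>x\<bar>) * \<bar>R - \<bar>x\<bar>\<bar> / 2 -
        (\<bar>x\<bar> * (\<bar>x\<bar> - R) + (\<bar>x\<bar> - R) * \<bar>\<bar>x\<bar> - R\<bar> / 2)) (at x)" if "x \<in> {- R..R}" for x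
      unfolding abs_eq[OF that]
      by (auto intro!: derivative_eq_intros simp: field_simps power2_eq_square)
  qed (auto intro!: continuous_intros simp: l1_norm_nonneg)
  also have "(R\<^sup>2 * R - R ^ 3 / 3) - (R\<^sup>2 * (- R) - (- R) ^ 3 / 3) = 4 / 3 * R ^ 3"
    by (simp add: power2_eq_square power3_eq_cube)
  finally show "(\<integral>\<^sup>+p. ennreal (l1_norm p * indicator {p. l1_norm p < R} p) \<partial>lborel) =
      ennreal (4 / 3 * R ^ 3)" .
qed (use assms in \<open>auto simp: l1_norm_nonneg\<close>)

section \<open>Second and third moments of a shifted geometric variable\<close>

text \<open>
  Moments of \<open>K + z\<close> for a geometric variable \<open>K\<close> of mean \<open>m\<close>, that is
  \<open>P(K = k) = (1 - b) b ^ k\<close> with \<open>m = b / (1 - b)\<close>.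
\<close>

definition mom2 :: "real \<Rightarrow> real \<Rightarrow> real" where
  "mom2 m z = z\<^sup>2 + 2 * m * z + 2 * m\<^sup>2 + m"

definition mom3 :: "real \<Rightarrow> real \<Rightarrow> real" where
  "mom3 m z = z ^ 3 + 3 * m * z\<^sup>2 + 3 * (2 * m\<^sup>2 + m) * z + 6 * m ^ 3 + 6 * m\<^sup>2 + m"

text \<open>Replaces the exponentials by polynomial relations between \<open>b\<close> and
  \<open>m\<close>, the form that \<open>algebra\<close> can use in the moment recurrences.\<close>

lemma geometric_mean_identity:
  assumes "\<epsilon> > (0::real)" "m = 1 / (exp \<epsilon> - 1)" "b = exp (- \<epsilon>)"
  shows "(1 - b) * (1 + m) = 1" "b * (1 + m) = m"
proof -
  have "exp \<epsilon> - 1 \<noteq> 0" "exp \<epsilon> * b = 1"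
    using assms by (simp_all flip: exp_add)
  moreover have "m * (exp \<epsilon> - 1) = 1"
    using \<open>exp \<epsilon> - 1 \<noteq> 0\<close> assms(2) by simp
  ultimately show "(1 - b) * (1 + m) = 1" "b * (1 + m) = m"
    by algebra+
qed

text \<open>Conditioning on \<open>K = 0\<close>, and since a geometric variable has no memory,
  \<open>mom2 m y = (1 - b) * y\<^sup>2 + b * mom2 m (y + 1)\<close>. Weighted by
  \<open>b ^ k\<close>, this telescopes. The third moment obeys the same recurrence with a
  cube.\<close>

lemma mom2_sums:
  assumes "\<epsilon> > 0"
  shows "(\<lambda>k. (1 - exp (- \<epsilon>)) * exp (- \<epsilon>) ^ k * (real k + z)\<^sup>2) sums mom2 (1 / (exp \<epsilon> - 1)) z"
proof -
  define m where "m = 1 / (exp \<epsilon> - 1)"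
  define b where "b = exp (- \<epsilon>)"
  note b = geometric_mean_identity[OF assms m_def b_def]
  have step: "mom2 m y - b * mom2 m (y + 1) = (1 - b) * y\<^sup>2" for y
    using b unfolding mom2_def by algebra
  have "(\<lambda>k. b ^ k * mom2 m (real k + z)) \<longlonglongrightarrow> 0"
    unfolding mom2_def b_def using assms by real_asymp
  from telescope_sums'[OF this]
  have "(\<lambda>k. b ^ k * (mom2 m (real k + z) - b * mom2 m (real k + z + 1))) sums mom2 m z"
    by (simp add: algebra_simps)
  then show ?thesis
    by (simp add: step mult_ac flip: b_def m_def)
qed

lemma mom3_sums:
  assumes "\<epsilon> > 0"
  shows "(\<lambda>k. (1 - exp (- \<epsilon>)) * exp (- \<epsilon>) ^ k * (real k + z) ^ 3) sums mom3 (1 / (exp \<epsilon> - 1)) z"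
proof -
  define m where "m = 1 / (exp \<epsilon> - 1)"
  define b where "b = exp (- \<epsilon>)"
  note b = geometric_mean_identity[OF assms m_def b_def]
  have step: "mom3 m y - b * mom3 m (y + 1) = (1 - b) * y ^ 3" for y
    using b unfolding mom3_def by algebra
  have "(\<lambda>k. b ^ k * mom3 m (real k + z)) \<longlonglongrightarrow> 0"
    unfolding mom3_def b_def using assms by real_asymp
  from telescope_sums'[OF this]
  have "(\<lambda>k. b ^ k * (mom3 m (real k + z) - b * mom3 m (real k + z + 1))) sums mom3 m z"
    by (simp add: algebra_simps)
  then show ?thesis
    by (simp add: step mult_ac flip: b_def m_def)
qed

section \<open>Closed form of the expected norm\<close>

lemma staircase_scale: "staircase a \<epsilon> \<Delta> \<gamma> x = a * staircase 1 \<epsilon> \<Delta> \<gamma> x"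
  by (simp add: staircase_def Let_def)

text \<open>A point lies in exactly the balls of index at least \<open>j\<close>, where
  \<open>j\<close> is its shell index \<open>k0\<close> inside the step and \<open>k0 + 1\<close>
  beyond it; the geometric weights from \<open>j\<close> on add up to \<open>b ^ j\<close>.\<close>

lemma staircase_sums:
  assumes "\<epsilon> > 0" "\<Delta> > 0" "\<gamma> \<in> {0..1}"
  shows "(\<lambda>k. (1 - exp (- \<epsilon>)) * exp (- \<epsilon>) ^ k * indicator {p. l1_norm p < (real k + \<gamma>) * \<Delta>} x)
    sums staircase 1 \<epsilon> \<Delta> \<gamma> x"
proof -
  define k0 where "k0 = nat \<lfloor>l1_norm x / \<Delta>\<rfloor>"
  define j where "j = (if l1_norm x < (real k0 + \<gamma>) * \<Delta> then k0 else Suc k0)"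
  define b where "b = exp (- \<epsilon>)"
  have b: "0 < b" "b < 1"
    using assms by (auto simp: b_def)
  have "0 \<le> l1_norm x / \<Delta>"
    using assms by (simp add: l1_norm_nonneg)
  then have "real k0 \<le> l1_norm x / \<Delta>" "l1_norm x / \<Delta> < real k0 + 1"
    unfolding k0_def by linarith+
  then have k0: "real k0 * \<Delta> \<le> l1_norm x" "l1_norm x < (real k0 + 1) * \<Delta>"
    using assms by (simp_all add: field_simps)
  have ball_iff: "l1_norm x < (real k + \<gamma>) * \<Delta> \<longleftrightarrow> j \<le> k" for k
  proof (cases k k0 rule: linorder_cases)
    case less
    then have "(real k + \<gamma>) * \<Delta> \<le> real k0 * \<Delta>"
      using assms by (intro mult_right_mono) auto
    with k0 less show ?thesis by (auto simp: j_def)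
  next
    case equal
    then show ?thesis by (auto simp: j_def)
  next
    case greater
    then have "(real k0 + 1) * \<Delta> \<le> (real k + \<gamma>) * \<Delta>"
      using assms by (intro mult_right_mono) auto
    with k0 greater show ?thesis by (auto simp: j_def)
  qed
  have "(\<lambda>k. b ^ k) \<longlonglongrightarrow> 0"
    using b by (intro LIMSEQ_power_zero) auto
  \<comment> \<open>This sequence is constant up to \<open>j\<close> and geometric afterwards, so
    its successive differences are the weights times the indicator.\<close>
  then have "(\<lambda>k. b ^ max j k) \<longlonglongrightarrow> 0"
    by (rule Lim_transform_eventually)
       (use eventually_ge_at_top[of j] in eventually_elim, simp add: max_def)
  from telescope_sums'[OF this]
  have "(\<lambda>k. b ^ max j k - b ^ max j (Suc k)) sums (b ^ j)"
    by simp
  also have "(\<lambda>k. b ^ max j k - b ^ max j (Suc k)) =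
      (\<lambda>k. (1 - b) * b ^ k * indicator {p. l1_norm p < (real k + \<gamma>) * \<Delta>} x)"
  proof
    show "b ^ max j k - b ^ max j (Suc k) =
        (1 - b) * b ^ k * indicator {p. l1_norm p < (real k + \<gamma>) * \<Delta>} x" for k
      by (cases "j \<le> k") (auto simp: indicator_def ball_iff max_def not_le left_diff_distrib le_Suc_eq)
  qed
  also have "b ^ j = staircase 1 \<epsilon> \<Delta> \<gamma> x"
    by (simp add: staircase_def b_def j_def k0_def Let_def algebra_simps flip: exp_of_nat_mult exp_add)
  finally show ?thesis
    by (simp add: b_def)
qed

text \<open>Sum and integral may be exchanged because all terms are nonnegative and their integrals
  form the convergent series for \<open>S\<close>. Applied with \<open>g = 1\<close> for the mass
  and \<open>g = l1_norm\<close> for the moment.\<close>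

lemma integral_staircase:
  assumes "\<epsilon> > 0" "\<Delta> > 0" "\<gamma> \<in> {0..1}" and g: "\<And>p. g p \<ge> 0"
    and J: "\<And>R. R \<ge> 0 \<Longrightarrow> has_bochner_integral lborel (\<lambda>p. g p * indicator {p. l1_norm p < R} p) (J R)"
    and S: "(\<lambda>k. (1 - exp (- \<epsilon>)) * exp (- \<epsilon>) ^ k * J ((real k + \<gamma>) * \<Delta>)) sums S"
  shows "(LINT p|lborel. g p * staircase 1 \<epsilon> \<Delta> \<gamma> p) = S"
proof -
  define w where "w k = (1 - exp (- \<epsilon>)) * exp (- \<epsilon>) ^ k" for k
  define f where "f k p = w k * (g p * indicator {p. l1_norm p < (real k + \<gamma>) * \<Delta>} p)" for k p
  have w: "w k \<ge> 0" for k
    using assms by (simp add: w_def)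
  have f_nonneg: "f k p \<ge> 0" for k p
    using w g by (simp add: f_def)
  have f: "has_bochner_integral lborel (f k) (w k * J ((real k + \<gamma>) * \<Delta>))" for k
    unfolding f_def using assms by (intro has_bochner_integral_mult_right J) auto
  have f_sums: "(\<lambda>k. f k p) sums (g p * staircase 1 \<epsilon> \<Delta> \<gamma> p)" for p
    using sums_mult[OF staircase_sums[OF assms(1-3)], of "g p" p]
    by (simp add: f_def w_def mult_ac)
  have "(\<lambda>k. integral\<^sup>L lborel (f k)) sums (LINT p|lborel. (\<Sum>k. f k p))"
  proof (rule sums_integral)
    show "integrable lborel (f k)" for k
      using f by (simp add: has_bochner_integral_iff)
    show "AE p in lborel. summable (\<lambda>k. norm (f k p))"
      using f_sums f_nonneg by (auto simp: sums_iff)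
    show "summable (\<lambda>k. LINT p|lborel. norm (f k p))"
      using S f_nonneg by (simp add: has_bochner_integral_integral_eq[OF f] w_def sums_iff)
  qed
  then have "(\<lambda>k. w k * J ((real k + \<gamma>) * \<Delta>)) sums (LINT p|lborel. g p * staircase 1 \<epsilon> \<Delta> \<gamma> p)"
    by (simp add: has_bochner_integral_integral_eq[OF f] sums_unique[OF f_sums, symmetric])
  with S show ?thesis
    unfolding w_def by (rule sums_unique2[symmetric])
qed

lemma mom2_pos:
  assumes "m > 0" "z \<ge> 0"
  shows "mom2 m z > 0"
  using assms by (simp add: mom2_def add_nonneg_pos)

lemma expected_l1_eq:
  assumes "\<epsilon> > 0" "\<Delta> > 0" "\<gamma> \<in> {0..1}"
  shows "expected_l1 \<epsilon> \<Delta> \<gamma> =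
    2 / 3 * \<Delta> * mom3 (1 / (exp \<epsilon> - 1)) \<gamma> / mom2 (1 / (exp \<epsilon> - 1)) \<gamma>"
proof -
  define m where "m = 1 / (exp \<epsilon> - 1)"
  have pos: "mom2 m \<gamma> > 0"
    using assms by (intro mom2_pos) (auto simp: m_def)
  have mass: "(LINT p|lborel. staircase a \<epsilon> \<Delta> \<gamma> p) = a * (2 * \<Delta>\<^sup>2 * mom2 m \<gamma>)" for a
  proof -
    have "(LINT p|lborel. 1 * staircase 1 \<epsilon> \<Delta> \<gamma> p) = 2 * \<Delta>\<^sup>2 * mom2 m \<gamma>"
    proof (rule integral_staircase[OF assms])
      show "(\<lambda>k. (1 - exp (- \<epsilon>)) * exp (- \<epsilon>) ^ k * (2 * ((real k + \<gamma>) * \<Delta>)\<^sup>2)) sums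
          (2 * \<Delta>\<^sup>2 * mom2 m \<gamma>)"
        using sums_mult[OF mom2_sums[OF assms(1)], of "2 * \<Delta>\<^sup>2" \<gamma>]
        by (simp add: m_def power_mult_distrib mult_ac)
    qed (use has_bochner_integral_l1_ball in simp_all)
    then show ?thesis
      by (subst staircase_scale) simp
  qed
  have moment: "(LINT p|lborel. l1_norm p * staircase 1 \<epsilon> \<Delta> \<gamma> p) = 4 / 3 * \<Delta> ^ 3 * mom3 m \<gamma>"
  proof (rule integral_staircase[OF assms l1_norm_nonneg has_bochner_integral_l1_norm_l1_ball])
    show "(\<lambda>k. (1 - exp (- \<epsilon>)) * exp (- \<epsilon>) ^ k * (4 / 3 * ((real k + \<gamma>) * \<Delta>) ^ 3)) sums
        (4 / 3 * \<Delta> ^ 3 * mom3 m \<gamma>)"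
      using sums_mult[OF mom3_sums[OF assms(1)], of "4 / 3 * \<Delta> ^ 3" \<gamma>]
      by (simp add: m_def power_mult_distrib mult_ac)
  qed
  \<comment> \<open>The mass is linear in \<open>a\<close> with positive slope, so exactly one
    \<open>a\<close> normalizes it.\<close>
  have norm_const: "norm_const \<epsilon> \<Delta> \<gamma> = 1 / (2 * \<Delta>\<^sup>2 * mom2 m \<gamma>)"
    unfolding norm_const_def mass using pos assms by (intro the_equality) (auto simp: field_simps)
  have "expected_l1 \<epsilon> \<Delta> \<gamma> = (LINT p|lborel. norm_const \<epsilon> \<Delta> \<gamma> * (l1_norm p * staircase 1 \<epsilon> \<Delta> \<gamma> p))"
    unfolding expected_l1_def staircase_density_def by (subst staircase_scale) (simp add: mult_ac)
  also have "\<dots> = 2 / 3 * \<Delta> * mom3 m \<gamma> / mom2 m \<gamma>"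
    using assms pos by (simp add: moment norm_const field_simps power2_eq_square power3_eq_cube)
  finally show ?thesis
    by (simp add: m_def)
qed

text \<open>The closed form is continuous on the compact interval, as its denominator is positive
  there.\<close>

lemma V_star_attained:
  assumes "\<epsilon> > 0" "\<Delta> > 0"
  obtains \<gamma> where "\<gamma> \<in> {0..1}" "\<And>\<gamma>'. \<gamma>' \<in> {0..1} \<Longrightarrow> expected_l1 \<epsilon> \<Delta> \<gamma> \<le> expected_l1 \<epsilon> \<Delta> \<gamma>'"
    "V_star \<Delta> \<epsilon> = expected_l1 \<epsilon> \<Delta> \<gamma>"
proof -
  define m where "m = 1 / (exp \<epsilon> - 1)"
  have "mom2 m \<gamma> \<noteq> 0" if "\<gamma> \<in> {0..1}" for \<gamma>
    using assms that mom2_pos[of m \<gamma>] by (force simp: m_def)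
  then have "continuous_on {0..1} (\<lambda>\<gamma>. 2 / 3 * \<Delta> * mom3 m \<gamma> / mom2 m \<gamma>)"
    unfolding mom2_def mom3_def by (intro continuous_intros) auto
  then have "continuous_on {0..1} (expected_l1 \<epsilon> \<Delta>)"
    using assms by (subst continuous_on_cong[OF refl expected_l1_eq]) (auto simp: m_def)
  then obtain \<gamma> where \<gamma>: "\<gamma> \<in> {0..1}" "\<And>\<gamma>'. \<gamma>' \<in> {0..1} \<Longrightarrow> expected_l1 \<epsilon> \<Delta> \<gamma> \<le> expected_l1 \<epsilon> \<Delta> \<gamma>'"
    using continuous_attains_inf[of "{0..1::real}" "expected_l1 \<epsilon> \<Delta>"] by auto
  then have "V_star \<Delta> \<epsilon> = expected_l1 \<epsilon> \<Delta> \<gamma>"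
    unfolding V_star_def by (intro cInf_eq_minimum) auto
  with \<gamma> show ?thesis by (intro that)
qed

section \<open>Expansion of the expected norm for small \<epsilon>\<close>

text \<open>In the centred variables \<open>mom3\<close> is \<open>3 * x * mom2\<close> plus a
  remainder of degree one in \<open>x\<close>, so \<open>2 * x\<close> splits off exactly. The error
  bound is uniform in \<open>t\<close> and hence survives minimization.\<close>

lemma mean_l1_expansion:
  fixes x t :: real
  assumes "x \<ge> 2" "\<bar>t\<bar> \<le> 1 / 2"
  shows "\<bar>2 / 3 * mom3 (x - 1 / 2) (t + 1 / 2) / mom2 (x - 1 / 2) (t + 1 / 2) -
    (2 * x - 1 / (6 * x) + (t ^ 3 - t / 4) / (3 * x\<^sup>2))\<bar> \<le> 1 / x ^ 3"
proof -
  define h where "h = t ^ 3 - t / 4"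
  define D where "D = 2 * x\<^sup>2 + 2 * x * t + t\<^sup>2 - 1 / 4"
  \<comment> \<open>The numerator of the error over \<open>6 * x\<^sup>2 * D\<close>: its cubic and
    quadratic terms in \<open>x\<close> cancel, the latter by the choice of
    \<open>h\<close>.\<close>
  define r where "r = x * (t\<^sup>2 - 1 / 4 - 4 * h * t) - 2 * h * (t\<^sup>2 - 1 / 4)"
  have mom2: "mom2 (x - 1 / 2) (t + 1 / 2) = D"
    by (simp add: mom2_def D_def field_simps power2_eq_square)
  have mom3: "mom3 (x - 1 / 2) (t + 1 / 2) = 3 * x * D + t ^ 3 - 3 / 4 * t - x / 2"
    by (simp add: mom3_def D_def field_simps power2_eq_square power3_eq_cube)
  have "t\<^sup>2 \<le> 1 / 4"
    using power_mono[OF assms(2) abs_ge_zero, of 2] by (simp add: power_divide)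
  then have t_sq: "\<bar>t\<^sup>2 - 1 / 4\<bar> \<le> 1 / 4"
    using zero_le_power2[of t] by linarith
  have h: "\<bar>h\<bar> \<le> 1 / 8"
  proof -
    have "h = t * (t\<^sup>2 - 1 / 4)"
      by (simp add: h_def algebra_simps power2_eq_square power3_eq_cube)
    then show ?thesis
      using mult_mono[OF assms(2) t_sq] by (simp add: abs_mult)
  qed
  have r: "\<bar>r\<bar> \<le> x"
  proof -
    have "\<bar>h * t\<bar> \<le> 1 / 16" "\<bar>h * (t\<^sup>2 - 1 / 4)\<bar> \<le> 1 / 32"
      using mult_mono[OF h assms(2)] mult_mono[OF h t_sq] by (simp_all add: abs_mult)
    then have "\<bar>t\<^sup>2 - 1 / 4 - 4 * h * t\<bar> \<le> 1 / 2" "\<bar>2 * h * (t\<^sup>2 - 1 / 4)\<bar> \<le> 1 / 16"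
      using t_sq by linarith+
    moreover from this have "\<bar>x * (t\<^sup>2 - 1 / 4 - 4 * h * t)\<bar> \<le> x * (1 / 2)"
      using assms(1) by (subst abs_mult) (simp add: mult_left_mono)
    ultimately show ?thesis
      unfolding r_def using assms(1) by linarith
  qed
  \<comment> \<open>Here \<open>x \<ge> 2\<close> lets one of the two squares in \<open>D\<close>
    absorb the lower-order terms.\<close>
  have "x\<^sup>2 \<ge> 2 * x" "\<bar>2 * x * t\<bar> \<le> x"
    using assms mult_left_mono[OF assms(2), of x] by (simp_all add: power2_eq_square abs_mult)
  then have D: "D \<ge> x\<^sup>2"
    using assms(1) zero_le_power2[of t] unfolding D_def by linarith
  moreover have "x\<^sup>2 > 0"
    using assms(1) by simp
  ultimately have "D > 0"
    by linarith
  have "2 / 3 * (3 * x * D + t ^ 3 - 3 / 4 * t - x / 2) / D - (2 * x - 1 / (6 * x) + h / (3 * x\<^sup>2)) =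
      (4 * x\<^sup>2 * (t ^ 3 - 3 / 4 * t - x / 2) + x * D - 2 * h * D) / (6 * x\<^sup>2 * D)"
    using assms(1) \<open>D > 0\<close> by (simp add: field_simps power2_eq_square)
  also have "4 * x\<^sup>2 * (t ^ 3 - 3 / 4 * t - x / 2) + x * D - 2 * h * D = r"
    by (simp add: r_def D_def h_def field_simps power2_eq_square power3_eq_cube)
  also have "\<bar>r / (6 * x\<^sup>2 * D)\<bar> \<le> x / (6 * x\<^sup>2 * x\<^sup>2)"
  proof -
    have "\<bar>r\<bar> / (6 * x\<^sup>2 * D) \<le> x / (6 * x\<^sup>2 * x\<^sup>2)"
      using r D \<open>x\<^sup>2 > 0\<close> assms(1) by (intro frac_le mult_left_mono) auto
    then show ?thesis
      using \<open>D > 0\<close> by (simp add: abs_mult)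
  qed
  also have "\<dots> \<le> 1 / x ^ 3"
    using assms(1) by (simp add: field_simps power2_eq_square power3_eq_cube)
  finally show ?thesis
    by (simp add: mom2 mom3 h_def)
qed

text \<open>\<open>s\<close> is the local minimum point of the cubic, hence a double root once the
  minimum value \<open>- 2 * s ^ 3\<close> is subtracted; the roots sum to 0, so the third one is
  \<open>- 2 * s\<close>.\<close>

lemma cubic_tangent:
  fixes t :: real
  defines "s \<equiv> 1 / (2 * sqrt 3)"
  shows "t ^ 3 - t / 4 = (t - s)\<^sup>2 * (t + 2 * s) - 1 / (12 * sqrt 3)"
proof -
  have "s * (sqrt 3 * 2) = 1" "sqrt 3 * sqrt 3 = 3"
    by (simp_all add: s_def)
  then have "12 * s\<^sup>2 = 1" "1 / (12 * sqrt 3) = 2 * s ^ 3"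
    by (simp_all add: s_def power2_eq_square power3_eq_cube)
  then show ?thesis by algebra
qed

section \<open>Two-sided bounds for large \<epsilon>\<close>

text \<open>
  Clearing the denominator leaves, up to the factor \<open>\<beta>\<^sup>3\<close>, the terms \<open>A\<close> of order at most one in \<open>\<beta>\<close>
  and the rest \<open>B\<close>. Since \<open>c\<^sup>3 = 2\<close>, both the leading term \<open>2 / 3 (y\<^sup>3 + 1) - c y\<^sup>2\<close> and the
  coefficient of \<open>\<beta>\<close> (without \<open>\<delta>\<close>) have a double root at \<open>y = c\<close>.
\<close>

lemma large_epsilon_lower:
  fixes c \<beta> \<delta> y :: real
  assumes c: "c ^ 3 = 2" "1 \<le> c" "c \<le> 2" and \<delta>: "0 < \<delta>" "\<delta> \<le> 1"
    and \<beta>: "0 < \<beta>" "\<beta> \<le> \<delta> / 56" and y: "y \<ge> 0"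
  shows "\<beta> * c + \<beta>\<^sup>2 * (1 / c - \<delta>) \<le> 2 / 3 * mom3 (\<beta> ^ 3) (\<beta> * y) / mom2 (\<beta> ^ 3) (\<beta> * y)"
proof -
  \<comment> \<open>\<open>1 / c - \<delta>\<close> with the reciprocal replaced by
    \<open>c\<^sup>2 / 2\<close>, so that the identity below is polynomial.\<close>
  define w where "w = c\<^sup>2 / 2 - \<delta>"
  have inv_c: "1 / c = c\<^sup>2 / 2"
    using c by (simp add: field_simps power2_eq_square power3_eq_cube)
  define A where "A = (y - c)\<^sup>2 * (2 / 3 * (y + c / 2) - \<beta> * (c\<^sup>2 / 2)) + \<beta> * \<delta> * y\<^sup>2"
  define B where "B = 2 * \<beta>\<^sup>2 * y\<^sup>2 + 4 * \<beta> ^ 4 * y + 4 * \<beta> ^ 6 + 4 * \<beta> ^ 3 -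
    c * (2 * \<beta>\<^sup>2 * y + 2 * \<beta> ^ 4) - w * (2 * \<beta> ^ 3 * y + 2 * \<beta> ^ 5 + \<beta>\<^sup>2)"
  \<comment> \<open>The last summand vanishes by \<open>c ^ 3 = 2\<close>; with it, the equation is
    an identity in free variables.\<close>
  have eq: "2 / 3 * mom3 (\<beta> ^ 3) (\<beta> * y) - (\<beta> * c + \<beta>\<^sup>2 * w) * mom2 (\<beta> ^ 3) (\<beta> * y) =
      \<beta> ^ 3 * (A + B) + \<beta> ^ 3 * (2 - c ^ 3) * (1 / 3 + \<beta> * y - \<beta> * c / 2)"
    unfolding mom3_def mom2_def A_def B_def w_def by (simp add: field_simps eval_nat_numeral)
  have \<beta>1: "\<beta> \<le> 1 / 56" "\<beta> \<le> 1"
    using \<beta> \<delta> by auto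
  have A: "A \<ge> \<beta> * \<delta> * ((1 + y) / 8)"
  proof -
    have "c\<^sup>2 \<le> 2\<^sup>2"
      using c by (intro power_mono) auto
    then have "\<beta> * (c\<^sup>2 / 2) \<le> 1 / 56 * 2"
      using \<beta> \<beta>1 by (intro mult_mono) auto
    moreover have "\<beta> * \<delta> \<le> 1 / 56 * 1"
      using \<beta> \<beta>1 \<delta> by (intro mult_mono) auto
    moreover have "2 / 3 * (y + c / 2) \<ge> 1 / 3"
      using c y by simp
    ultimately have "\<beta> * \<delta> \<le> 2 / 3 * (y + c / 2) - \<beta> * (c\<^sup>2 / 2)"
      by linarith
    then have "(y - c)\<^sup>2 * (\<beta> * \<delta>) \<le> (y - c)\<^sup>2 * (2 / 3 * (y + c / 2) - \<beta> * (c\<^sup>2 / 2))"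
      by (intro mult_left_mono) auto
    then have "A \<ge> \<beta> * \<delta> * ((y - c)\<^sup>2 + y\<^sup>2)"
      by (simp add: A_def algebra_simps)
    \<comment> \<open>The two squares cannot both be small since \<open>c \<ge> 1\<close>; the bound
      follows by completing the square in \<open>2 * y - c\<close>.\<close>
    moreover have "(y - c)\<^sup>2 + y\<^sup>2 \<ge> (1 + y) / 8"
    proof -
      have "(y - c)\<^sup>2 + y\<^sup>2 - (1 + y) / 8 = (2 * y - c)\<^sup>2 / 2 - (2 * y - c) / 16 + (c\<^sup>2 / 2 - c / 16 - 1 / 8)"
        by (simp add: field_simps power2_eq_square)
      also have "\<dots> = (2 * y - c - 1 / 16)\<^sup>2 / 2 + (c * (c - 1 / 8) / 2 - 1 / 8 - 1 / 512)"
        by (simp add: field_simps power2_eq_square)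
      also have "\<dots> \<ge> 0"
        using mult_mono[of 1 c "7/8" "c - 1/8"] c by (intro add_nonneg_nonneg) auto
      finally show ?thesis by simp
    qed
    then have "\<beta> * \<delta> * ((y - c)\<^sup>2 + y\<^sup>2) \<ge> \<beta> * \<delta> * ((1 + y) / 8)"
      using \<beta> \<delta> by (intro mult_left_mono) auto
    ultimately show ?thesis by linarith
  qed
  have pow: "\<beta> ^ n \<le> \<beta>\<^sup>2" if "n \<ge> 2" for n
    using that \<beta> \<beta>1 by (intro power_decreasing) auto
  have B: "B \<ge> - (7 * \<beta>\<^sup>2 * (1 + y))"
  proof -
    have "c * (2 * \<beta>\<^sup>2 * y + 2 * \<beta> ^ 4) \<le> 2 * (2 * \<beta>\<^sup>2 * y + 2 * \<beta>\<^sup>2)"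
      using c y \<beta> pow[of 4] by (intro mult_mono add_mono mult_right_mono mult_left_mono) auto
    moreover have "w \<le> 1"
      using c \<delta> inv_c divide_le_eq_1[of 1 c] unfolding w_def by linarith
    then have "w * (2 * \<beta> ^ 3 * y + 2 * \<beta> ^ 5 + \<beta>\<^sup>2) \<le> 1 * (2 * \<beta>\<^sup>2 * y + 2 * \<beta>\<^sup>2 + \<beta>\<^sup>2)"
      using y \<beta> pow[of 3] pow[of 5] by (intro mult_mono add_mono mult_right_mono mult_left_mono) auto
    moreover have "2 * \<beta>\<^sup>2 * y\<^sup>2 + 4 * \<beta> ^ 4 * y + 4 * \<beta> ^ 6 + 4 * \<beta> ^ 3 \<ge> 0" "\<beta>\<^sup>2 * y \<ge> 0"
      using y \<beta> by simp_all
    ultimately show ?thesis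
      unfolding B_def by (simp add: algebra_simps)
  qed
  \<comment> \<open>The constant 56 is the 7 from the bound on \<open>B\<close> times the 8 from the
    bound on \<open>A\<close>.\<close>
  have "7 * \<beta>\<^sup>2 * (1 + y) \<le> \<beta> * \<delta> * ((1 + y) / 8)"
    using mult_right_mono[OF \<beta>(2), of "\<beta> * (7 * (1 + y))"] \<beta> y by (simp add: field_simps power2_eq_square)
  with A B have "\<beta> ^ 3 * (A + B) \<ge> 0"
    using \<beta> by simp
  then show ?thesis
    using eq c(1) mom2_pos[of "\<beta> ^ 3" "\<beta> * y"] \<beta> y by (simp add: pos_le_divide_eq inv_c w_def)
qed

text \<open>At the test point \<open>y = c\<close> the double-root terms vanish. The margin
  \<open>\<beta> * \<delta> * c\<^sup>2\<close> then dominates the positive terms \<open>P\<close>,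
  which are at most \<open>24 * \<beta>\<^sup>2\<close>.\<close>

lemma large_epsilon_upper:
  fixes c \<beta> \<delta> :: real
  assumes c: "c ^ 3 = 2" "1 \<le> c" "c \<le> 2" and \<delta>: "0 < \<delta>" "\<delta> \<le> 1"
    and \<beta>: "0 < \<beta>" "\<beta> \<le> \<delta> / 56"
  shows "2 / 3 * mom3 (\<beta> ^ 3) (\<beta> * c) / mom2 (\<beta> ^ 3) (\<beta> * c) \<le> \<beta> * c + \<beta>\<^sup>2 * (1 / c + \<delta>)"
proof -
  define w where "w = c\<^sup>2 / 2 + \<delta>"
  have inv_c: "1 / c = c\<^sup>2 / 2"
    using c by (simp add: field_simps power2_eq_square power3_eq_cube)
  define P where "P = 2 * \<beta>\<^sup>2 * c\<^sup>2 + 4 * \<beta> ^ 4 * c + 4 * \<beta> ^ 6 + 4 * \<beta> ^ 3"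
  define N where "N = c * (2 * \<beta>\<^sup>2 * c + 2 * \<beta> ^ 4) + w * (2 * \<beta> ^ 3 * c + 2 * \<beta> ^ 5 + \<beta>\<^sup>2)"
  have eq: "2 / 3 * mom3 (\<beta> ^ 3) (\<beta> * c) - (\<beta> * c + \<beta>\<^sup>2 * w) * mom2 (\<beta> ^ 3) (\<beta> * c) =
      \<beta> ^ 3 * (P - N - \<beta> * \<delta> * c\<^sup>2) + \<beta> ^ 3 * (2 - c ^ 3) * (1 / 3 + \<beta> * c / 2)"
    unfolding mom3_def mom2_def P_def N_def w_def by (simp add: field_simps eval_nat_numeral)
  have pow: "\<beta> ^ n \<le> \<beta>\<^sup>2" if "n \<ge> 2" for n
    using that \<beta> \<delta> by (intro power_decreasing) auto
  have "P \<le> 2 * \<beta>\<^sup>2 * 2\<^sup>2 + 4 * \<beta>\<^sup>2 * 2 + 4 * \<beta>\<^sup>2 + 4 * \<beta>\<^sup>2"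
    unfolding P_def using pow[of 3] pow[of 4] pow[of 6] \<beta> c by (intro add_mono mult_mono power_mono) auto
  also have "\<dots> \<le> \<beta> * \<delta> * 1"
    using mult_right_mono[OF \<beta>(2), of "\<beta>"] \<beta> by (simp add: field_simps power2_eq_square)
  also have "\<dots> \<le> \<beta> * \<delta> * c\<^sup>2"
    using \<beta> \<delta> c by (intro mult_left_mono) auto
  finally have "P \<le> \<beta> * \<delta> * c\<^sup>2" .
  moreover have "N \<ge> 0"
    using \<beta> \<delta> c by (simp add: N_def w_def)
  ultimately have "\<beta> ^ 3 * (P - N - \<beta> * \<delta> * c\<^sup>2) \<le> 0"
    using \<beta> by (intro mult_nonneg_nonpos) auto
  then show ?thesis
    using eq c(1) mom2_pos[of "\<beta> ^ 3" "\<beta> * c"] \<beta> c by (simp add: pos_divide_le_eq inv_c w_def)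
qed

section \<open>Asymptotics of the minimum\<close>

lemma V_star_le:
  assumes "\<epsilon> > 0" "\<Delta> > 0" "\<gamma> \<in> {0..1}"
  shows "V_star \<Delta> \<epsilon> \<le> \<Delta> * (2 / 3 * mom3 (1 / (exp \<epsilon> - 1)) \<gamma> / mom2 (1 / (exp \<epsilon> - 1)) \<gamma>)"
proof -
  obtain \<gamma>' where "V_star \<Delta> \<epsilon> = expected_l1 \<epsilon> \<Delta> \<gamma>'" "expected_l1 \<epsilon> \<Delta> \<gamma>' \<le> expected_l1 \<epsilon> \<Delta> \<gamma>"
    using assms by (metis V_star_attained)
  then show ?thesis
    using expected_l1_eq[OF assms] by (simp add: mult_ac)
qed

lemma le_V_star:
  assumes "\<epsilon> > 0" "\<Delta> > 0"
    and "\<And>\<gamma>. \<gamma> \<in> {0..1} \<Longrightarrow> v \<le> 2 / 3 * mom3 (1 / (exp \<epsilon> - 1)) \<gamma> / mom2 (1 / (exp \<epsilon> - 1)) \<gamma>"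
  shows "\<Delta> * v \<le> V_star \<Delta> \<epsilon>"
proof -
  obtain \<gamma> where \<gamma>: "\<gamma> \<in> {0..1}" "V_star \<Delta> \<epsilon> = expected_l1 \<epsilon> \<Delta> \<gamma>"
    using assms(1,2) by (metis V_star_attained)
  show ?thesis
    using mult_left_mono[OF assms(3)[OF \<gamma>(1)], of \<Delta>] assms(2)
    unfolding \<gamma>(2) expected_l1_eq[OF assms(1,2) \<gamma>(1)] by (simp add: mult_ac)
qed

text \<open>The upper bound takes the test point \<open>t = s\<close>, the lower bound the global
  minimality of \<open>s\<close>; both give \<open>F\<close> up to \<open>1 / x ^ 3\<close>, which
  is of order \<open>\<epsilon> ^ 3\<close>.\<close>

lemma V_star_small_epsilon:
  assumes "\<Delta> > 0"
  shows "(\<lambda>\<epsilon>. V_star \<Delta> \<epsilon> - (2 * \<Delta> / \<epsilon> - \<Delta> * \<epsilon> ^ 2 / (36 * sqrt 3))) \<in> O[at_right 0](\<lambda>\<epsilon>. \<epsilon> ^ 3)"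
proof -
  define x :: "real \<Rightarrow> real" where "x \<epsilon> = 1 / (exp \<epsilon> - 1) + 1 / 2" for \<epsilon>
  define F where "F \<epsilon> = 2 * x \<epsilon> - 1 / (6 * x \<epsilon>) - 1 / (36 * sqrt 3 * (x \<epsilon>)\<^sup>2)" for \<epsilon>
  define s :: real where "s = 1 / (2 * sqrt 3)"
  \<comment> \<open>\<open>s \<le> 1 / 2\<close> makes \<open>s + 1 / 2\<close> an admissible
    \<gamma>; \<open>1 / 2 \<le> 2 * s\<close> keeps \<open>t + 2 * s\<close> nonnegative on the
    whole range of \<open>t\<close>.\<close>
  have s: "0 < s" "s \<le> 1 / 2" "1 / 2 \<le> 2 * s"
    using real_sqrt_le_mono[of 3 4] by (simp_all add: s_def field_simps)
  have bound: "\<bar>V_star \<Delta> \<epsilon> - \<Delta> * F \<epsilon>\<bar> \<le> \<Delta> * (1 / x \<epsilon> ^ 3)" if \<epsilon>: "\<epsilon> > 0" "x \<epsilon> \<ge> 2" for \<epsilon>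
  proof -
    have m: "1 / (exp \<epsilon> - 1) = x \<epsilon> - 1 / 2"
      by (simp add: x_def)
    have "V_star \<Delta> \<epsilon> \<le> \<Delta> * (2 / 3 * mom3 (x \<epsilon> - 1 / 2) (s + 1 / 2) / mom2 (x \<epsilon> - 1 / 2) (s + 1 / 2))"
      using V_star_le[OF \<epsilon>(1) assms, of "s + 1 / 2"] s unfolding m by simp
    also have "\<dots> \<le> \<Delta> * (F \<epsilon> + 1 / x \<epsilon> ^ 3)"
    proof (rule mult_left_mono)
      have "s ^ 3 - s / 4 = - (1 / (12 * sqrt 3))"
        using cubic_tangent[of s] by (simp add: s_def)
      then have "(s ^ 3 - s / 4) / (3 * (x \<epsilon>)\<^sup>2) = - (1 / (36 * sqrt 3 * (x \<epsilon>)\<^sup>2))"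
        by simp
      then show "2 / 3 * mom3 (x \<epsilon> - 1 / 2) (s + 1 / 2) / mom2 (x \<epsilon> - 1 / 2) (s + 1 / 2) \<le> F \<epsilon> + 1 / x \<epsilon> ^ 3"
        using mean_l1_expansion[OF \<epsilon>(2), of s] s unfolding F_def by linarith
    qed (use assms in simp)
    finally have upper: "V_star \<Delta> \<epsilon> \<le> \<Delta> * (F \<epsilon> + 1 / x \<epsilon> ^ 3)" .
    have "\<Delta> * (F \<epsilon> - 1 / x \<epsilon> ^ 3) \<le> V_star \<Delta> \<epsilon>"
    proof (rule le_V_star[OF \<epsilon>(1) assms], unfold m)
      fix \<gamma> :: real assume \<gamma>: "\<gamma> \<in> {0..1}"
      define t where "t = \<gamma> - 1 / 2"
      have t: "\<bar>t\<bar> \<le> 1 / 2" "\<gamma> = t + 1 / 2"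
        using \<gamma> by (auto simp: t_def abs_if)
      have "(t - s)\<^sup>2 * (t + 2 * s) \<ge> 0"
        using t s by (intro mult_nonneg_nonneg) (auto simp: abs_le_iff)
      then have "t ^ 3 - t / 4 \<ge> - (1 / (12 * sqrt 3))"
        using cubic_tangent[of t] by (simp add: s_def)
      then have "- (1 / (12 * sqrt 3)) / (3 * (x \<epsilon>)\<^sup>2) \<le> (t ^ 3 - t / 4) / (3 * (x \<epsilon>)\<^sup>2)"
        by (intro divide_right_mono) auto
      then have "- (1 / (36 * sqrt 3 * (x \<epsilon>)\<^sup>2)) \<le> (t ^ 3 - t / 4) / (3 * (x \<epsilon>)\<^sup>2)"
        by simp
      then show "F \<epsilon> - 1 / x \<epsilon> ^ 3 \<le> 2 / 3 * mom3 (x \<epsilon> - 1 / 2) \<gamma> / mom2 (x \<epsilon> - 1 / 2) \<gamma>"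
        using mean_l1_expansion[OF \<epsilon>(2) t(1)] unfolding F_def t(2) by linarith
    qed
    with upper show ?thesis
      by (simp add: abs_le_iff algebra_simps)
  qed
  have "eventually (\<lambda>\<epsilon>. x \<epsilon> \<ge> 2) (at_right 0)"
    unfolding x_def by real_asymp
  moreover have "eventually (\<lambda>\<epsilon>::real. \<epsilon> > 0) (at_right 0)"
    by (simp add: eventually_at_filter)
  ultimately have "eventually (\<lambda>\<epsilon>. norm (V_star \<Delta> \<epsilon> - \<Delta> * F \<epsilon>) \<le> \<Delta> * norm (1 / x \<epsilon> ^ 3)) (at_right 0)"
  proof eventually_elim
    case (elim \<epsilon>)
    then show ?case using bound[of \<epsilon>] by simp
  qed
  then have "(\<lambda>\<epsilon>. V_star \<Delta> \<epsilon> - \<Delta> * F \<epsilon>) \<in> O[at_right 0](\<lambda>\<epsilon>. 1 / x \<epsilon> ^ 3)"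
    by (rule bigoI)
  also have "(\<lambda>\<epsilon>. 1 / x \<epsilon> ^ 3) \<in> O[at_right 0](\<lambda>\<epsilon>. \<epsilon> ^ 3)"
    unfolding x_def by real_asymp
  finally have 1: "(\<lambda>\<epsilon>. V_star \<Delta> \<epsilon> - \<Delta> * F \<epsilon>) \<in> O[at_right 0](\<lambda>\<epsilon>. \<epsilon> ^ 3)" .
  \<comment> \<open>Since \<open>x \<epsilon>\<close> is
    \<open>1 / \<epsilon> + \<epsilon> / 12 + O(\<epsilon> ^ 3)\<close>, the linear terms of
    \<open>2 * x\<close> and \<open>1 / (6 * x)\<close> cancel.\<close>
  have "(\<lambda>\<epsilon>. F \<epsilon> - (2 / \<epsilon> - \<epsilon> ^ 2 / (36 * sqrt 3))) \<in> O[at_right 0](\<lambda>\<epsilon>. \<epsilon> ^ 3)"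
    unfolding F_def x_def by real_asymp
  then have "(\<lambda>\<epsilon>. \<Delta> * (F \<epsilon> - (2 / \<epsilon> - \<epsilon> ^ 2 / (36 * sqrt 3)))) \<in> O[at_right 0](\<lambda>\<epsilon>. \<epsilon> ^ 3)"
    using assms by (subst landau_o.big.cmult_in_iff) simp_all
  from sum_in_bigo(1)[OF 1 this] show ?thesis
    by (simp add: algebra_simps)
qed

text \<open>The bounds with slack \<open>\<delta> * \<beta>\<^sup>2\<close> hold once \<beta> is
  small compared with \<delta>; letting \<delta> be arbitrary turns them into a little-o of
  \<open>\<beta>\<^sup>2\<close>.\<close>

lemma V_star_large_epsilon:
  assumes "\<Delta> > 0"
  shows "(\<lambda>\<epsilon>. V_star \<Delta> \<epsilon> - (root 3 2 * \<Delta> * exp (- \<epsilon> / 3) + \<Delta> * exp (- 2 * \<epsilon> / 3) / root 3 2))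
    \<in> o[at_top](\<lambda>\<epsilon>. exp (- 2 * \<epsilon> / 3))"
proof -
  define c where "c = root 3 (2::real)"
  have c: "c ^ 3 = 2" "1 \<le> c" "c \<le> 2"
    using real_root_le_mono[of 3 2 8] real_root_power_cancel[of 3 2] by (simp_all add: c_def)
  define \<beta> :: "real \<Rightarrow> real" where "\<beta> \<epsilon> = (1 / (exp \<epsilon> - 1)) powr (1 / 3)" for \<epsilon>
  define F where "F \<epsilon> = c * \<beta> \<epsilon> + (\<beta> \<epsilon>)\<^sup>2 / c" for \<epsilon>
  have \<beta>_cube: "\<beta> \<epsilon> ^ 3 = 1 / (exp \<epsilon> - 1)" if "\<epsilon> > 0" for \<epsilon>
    using that by (simp add: \<beta>_def powr_power)
  have bound: "\<bar>V_star \<Delta> \<epsilon> - \<Delta> * F \<epsilon>\<bar> \<le> \<Delta> * \<delta> * (\<beta> \<epsilon>)\<^sup>2"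
    if \<epsilon>: "\<epsilon> > 0" "\<beta> \<epsilon> \<le> \<delta> / 56" and \<delta>: "0 < \<delta>" "\<delta> \<le> 1" for \<epsilon> \<delta>
  proof -
    have \<beta>: "\<beta> \<epsilon> > 0"
      using \<epsilon> by (simp add: \<beta>_def)
    \<comment> \<open>Ensures that the test point \<open>\<gamma> = \<beta> * c\<close> lies in the
      unit interval.\<close>
    have "\<beta> \<epsilon> * c \<le> 1 / 56 * 2"
      using \<epsilon> \<beta> \<delta> c by (intro mult_mono) auto
    then have "V_star \<Delta> \<epsilon> \<le> \<Delta> * (2 / 3 * mom3 (\<beta> \<epsilon> ^ 3) (\<beta> \<epsilon> * c) / mom2 (\<beta> \<epsilon> ^ 3) (\<beta> \<epsilon> * c))"
      using V_star_le[OF \<epsilon>(1) assms, of "\<beta> \<epsilon> * c"] \<beta> c unfolding \<beta>_cube[OF \<epsilon>(1)] by simp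
    also have "\<dots> \<le> \<Delta> * (\<beta> \<epsilon> * c + (\<beta> \<epsilon>)\<^sup>2 * (1 / c + \<delta>))"
      using large_epsilon_upper[OF c \<delta> \<beta> \<epsilon>(2)] assms by (intro mult_left_mono) auto
    finally have "V_star \<Delta> \<epsilon> - \<Delta> * F \<epsilon> \<le> \<Delta> * \<delta> * (\<beta> \<epsilon>)\<^sup>2"
      by (simp add: F_def algebra_simps)
    moreover have "\<Delta> * (\<beta> \<epsilon> * c + (\<beta> \<epsilon>)\<^sup>2 * (1 / c - \<delta>)) \<le> V_star \<Delta> \<epsilon>"
    proof (rule le_V_star[OF \<epsilon>(1) assms])
      fix \<gamma> :: real assume "\<gamma> \<in> {0..1}"
      then show "\<beta> \<epsilon> * c + (\<beta> \<epsilon>)\<^sup>2 * (1 / c - \<delta>) \<le>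
          2 / 3 * mom3 (1 / (exp \<epsilon> - 1)) \<gamma> / mom2 (1 / (exp \<epsilon> - 1)) \<gamma>"
        using large_epsilon_lower[OF c \<delta> \<beta> \<epsilon>(2), of "\<gamma> / \<beta> \<epsilon>"] \<beta>
        by (simp add: \<beta>_cube[OF \<epsilon>(1)])
    qed
    then have "- (\<Delta> * \<delta> * (\<beta> \<epsilon>)\<^sup>2) \<le> V_star \<Delta> \<epsilon> - \<Delta> * F \<epsilon>"
      by (simp add: F_def algebra_simps)
    ultimately show ?thesis by linarith
  qed
  have "(\<lambda>\<epsilon>. V_star \<Delta> \<epsilon> - \<Delta> * F \<epsilon>) \<in> o[at_top](\<lambda>\<epsilon>. (\<beta> \<epsilon>)\<^sup>2)"
  proof (rule landau_o.smallI)
    fix e :: real assume "e > 0"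
    define \<delta> where "\<delta> = min 1 (e / \<Delta>)"
    have \<delta>: "0 < \<delta>" "\<delta> \<le> 1" "\<Delta> * \<delta> \<le> e"
      using \<open>e > 0\<close> assms by (auto simp: \<delta>_def min_def field_simps)
    have "(\<beta> \<longlongrightarrow> 0) at_top"
      unfolding \<beta>_def by real_asymp
    then have "eventually (\<lambda>\<epsilon>. \<beta> \<epsilon> < \<delta> / 56) at_top"
      using \<delta> by (intro order_tendstoD) auto
    then show "eventually (\<lambda>\<epsilon>. norm (V_star \<Delta> \<epsilon> - \<Delta> * F \<epsilon>) \<le> e * norm ((\<beta> \<epsilon>)\<^sup>2)) at_top"
      using eventually_gt_at_top[of 0]
    proof eventually_elim
      case (elim \<epsilon>)
      then have "\<bar>V_star \<Delta> \<epsilon> - \<Delta> * F \<epsilon>\<bar> \<le> \<Delta> * \<delta> * (\<beta> \<epsilon>)\<^sup>2"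
        using \<delta> by (intro bound) auto
      also have "\<dots> \<le> e * (\<beta> \<epsilon>)\<^sup>2"
        using \<delta> by (intro mult_right_mono) auto
      finally show ?case by simp
    qed
  qed
  also have "(\<lambda>\<epsilon>. (\<beta> \<epsilon>)\<^sup>2) \<in> O[at_top](\<lambda>\<epsilon>. exp (- 2 * \<epsilon> / 3))"
    unfolding \<beta>_def by real_asymp
  finally have 1: "(\<lambda>\<epsilon>. V_star \<Delta> \<epsilon> - \<Delta> * F \<epsilon>) \<in> o[at_top](\<lambda>\<epsilon>. exp (- 2 * \<epsilon> / 3))" .
  have "c > 0"
    using c by simp
  \<comment> \<open>\<beta> differs from \<open>exp (- \<epsilon> / 3)\<close> only by
    \<open>O(exp (- 4 * \<epsilon> / 3))\<close>, below the precision claimed.\<close>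
  then have "(\<lambda>\<epsilon>. F \<epsilon> - (c * exp (- \<epsilon> / 3) + exp (- 2 * \<epsilon> / 3) / c)) \<in> o[at_top](\<lambda>\<epsilon>. exp (- 2 * \<epsilon> / 3))"
    unfolding F_def \<beta>_def by real_asymp
  then have "(\<lambda>\<epsilon>. \<Delta> * (F \<epsilon> - (c * exp (- \<epsilon> / 3) + exp (- 2 * \<epsilon> / 3) / c))) \<in> o[at_top](\<lambda>\<epsilon>. exp (- 2 * \<epsilon> / 3))"
    using assms by (subst landau_o.small.cmult_in_iff) simp_all
  from sum_in_smallo(1)[OF 1 this] show ?thesis
    by (simp add: c_def algebra_simps)
qed

theorem corollary2:
  fixes \<Delta> :: real
  assumes "\<Delta> > 0"
  shows "(\<forall>\<epsilon>>0. \<exists>\<gamma>. is_arg_min (expected_l1 \<epsilon> \<Delta>) (\<lambda>\<gamma>. \<gamma> \<in> {0..1}) \<gamma> \<and>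
                     V_star \<Delta> \<epsilon> = expected_l1 \<epsilon> \<Delta> \<gamma>) \<and>
         (\<lambda>\<epsilon>. V_star \<Delta> \<epsilon> - (2 * \<Delta> / \<epsilon> - \<Delta> * \<epsilon> ^ 2 / (36 * sqrt 3)))
           \<in> O[at_right 0](\<lambda>\<epsilon>. \<epsilon> ^ 3) \<and>
         (\<lambda>\<epsilon>. V_star \<Delta> \<epsilon> - (root 3 2 * \<Delta> * exp (- \<epsilon> / 3) + \<Delta> * exp (- 2 * \<epsilon> / 3) / root 3 2))
           \<in> o[at_top](\<lambda>\<epsilon>. exp (- 2 * \<epsilon> / 3))"
proof (intro conjI allI impI)
  fix \<epsilon> :: real assume "\<epsilon> > 0"
  then obtain \<gamma> where "\<gamma> \<in> {0..1}" "\<And>\<gamma>'. \<gamma>' \<in> {0..1} \<Longrightarrow> expected_l1 \<epsilon> \<Delta> \<gamma> \<le> expected_l1 \<epsilon> \<Delta> \<gamma>'"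
    "V_star \<Delta> \<epsilon> = expected_l1 \<epsilon> \<Delta> \<gamma>"
    using V_star_attained[OF _ assms] by blast
  then show "\<exists>\<gamma>. is_arg_min (expected_l1 \<epsilon> \<Delta>) (\<lambda>\<gamma>. \<gamma> \<in> {0..1}) \<gamma> \<and> V_star \<Delta> \<epsilon> = expected_l1 \<epsilon> \<Delta> \<gamma>"
    unfolding is_arg_min_def by (meson not_less)
qed (use V_star_small_epsilon[OF assms] V_star_large_epsilon[OF assms] in auto)

end
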